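(* Let $(\mathsf{X},\mathsf{d},\mathfrak{m})$ be a proper metric measure space with $\mathfrak{m}$ doubling on $\mathsf{X}$, and let $c:\mathsf{X}\times\mathsf{X}\to[0,\infty]$ be a lower semicontinuous cost function satisfying the Local Metric Twist Condition [LMTC]. Then for every pair $\mu,\nu\in\mathscr{P}(\mathsf{X})$ with $\mu\ll\mathfrak{m}$ and $\mathsf{OptPlans}(\mu,\nu)\neq\emptyset$, there exists a unique optimal transport plan $\pi\in\mathsf{OptPlans}(\mu,\nu)$, and it is induced by a map; equivalently, there is a unique (up to $\mu$-a.e. equality) optimal transport map for the Monge problem $\inf\{\int c(x,T(x))\,d\mu(x): T \text{ Borel}, T_\#\mu=\nu\}$.
   Context: A metric measure space is a triple $(\mathsf{X},\mathsf{d},\mathfrak{m})$ with $(\mathsf{X},\mathsf{d})$ a Polish metric space and $\mathfrak{m}$ a locally finite Borel measure; it is proper if closed bounded sets are compact. $\mathfrak{m}$ is doubling if there is $C>0$ with $\mathfrak{m}(B_{2r}(x))\le C\,\mathfrak{m}(B_r(x))$ for all $x\in\mathsf{X}$, $r>0$. $\mathsf{Adm}(\mu,\nu)$ is the set of probability measures $\pi$ on $\mathsf{X}\times\mathsf{X}$ with first marginal $\mu$ and second marginal $\nu$; $\mathsf{OptPlans}(\mu,\nu)$ is the set of minimisers of $\pi\mapsto\int c\,d\pi$ over $\mathsf{Adm}(\mu,\nu)$ when the infimum is finite. A plan $\pi$ is induced by a map if $\pi=(\mathrm{id},T)_\#\mu$ for some $\mu$-measurable $T:\mathsf{X}\to\mathsf{X}$.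 For $x,y,z\in\mathsf{X}$, $s,r>0$, set $F_{s|r}(x|y,z):=\{x'\in B_s(x): c(x',y')+c(x,z')<c(x,y')+c(x',z')\ \ \forall y'\in B_r(y),\,z'\in B_r(z)\}$. The cost $c$ satisfies [LMTC] if for every $x,y,z\in\mathsf{X}$ with $y\ne z$ there exist $r_1,r_2>0$ such that for every $\bar x\in B_{r_1}(x)$, $\liminf_{s\to0}\frac{\mathfrak{m}(F_{s|r_2}(\bar x|y,z))}{\mathfrak{m}(B_s(\bar x))}>0.$ *)

theory Defs
  imports "HOL-Probability.Probability"
begin

definition proper_space :: "'a::metric_space itself \<Rightarrow> bool" where
  "proper_space _ \<longleftrightarrow> (\<forall>S::'a set. closed S \<and> bounded S \<longrightarrow> compact S)"

definition locally_finite_borel :: "'a::metric_space measure \<Rightarrow> bool" where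
  "locally_finite_borel m \<longleftrightarrow> sets m = sets borel \<and>
     (\<forall>x. \<exists>r>0. emeasure m (ball x r) < \<infinity>)"

definition doubling :: "'a::metric_space measure \<Rightarrow> bool" where
  "doubling m \<longleftrightarrow> (\<exists>C::real>0. \<forall>x r. r > 0 \<longrightarrow>
      emeasure m (ball x (2 * r)) \<le> ennreal C * emeasure m (ball x r))"

definition prob_measures :: "'a::topological_space measure set" where
  "prob_measures = {M. prob_space M \<and> sets M = sets borel}"

definition lsc :: "('a::topological_space \<Rightarrow> ennreal) \<Rightarrow> bool" where
  "lsc f \<longleftrightarrow> (\<forall>t. open {p. t < f p})"

definition Adm :: "'a::polish_space measure \<Rightarrow> 'a measure \<Rightarrow> ('a \<times> 'a) measure set" where
  "Adm \<mu> \<nu> = {\<pi>. prob_space \<pi> \<and> sets \<pi> = sets borel \<and>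
                 distr \<pi> borel fst = \<mu> \<and> distr \<pi> borel snd = \<nu>}"

definition OptPlans :: "('a::polish_space \<times> 'a \<Rightarrow> ennreal) \<Rightarrow> 'a measure \<Rightarrow> 'a measure
    \<Rightarrow> ('a \<times> 'a) measure set" where
  "OptPlans c \<mu> \<nu> = {\<pi> \<in> Adm \<mu> \<nu>. (\<integral>\<^sup>+ p. c p \<partial>\<pi>) < \<infinity> \<and>
       (\<forall>\<pi>' \<in> Adm \<mu> \<nu>. (\<integral>\<^sup>+ p. c p \<partial>\<pi>) \<le> (\<integral>\<^sup>+ p. c p \<partial>\<pi>'))}"

definition induced_by_map :: "('a::polish_space \<times> 'a) measure \<Rightarrow> 'a measure \<Rightarrow> bool" where
  "induced_by_map \<pi> \<mu> \<longleftrightarrow>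
     (\<exists>T. T \<in> borel_measurable \<mu> \<and> \<pi> = distr \<mu> borel (\<lambda>x. (x, T x)))"

definition Fset :: "('a::metric_space \<times> 'a \<Rightarrow> ennreal) \<Rightarrow> real \<Rightarrow> real \<Rightarrow> 'a \<Rightarrow> 'a \<Rightarrow> 'a \<Rightarrow> 'a set" where
  "Fset c s r x y z = {x' \<in> ball x s. \<forall>y' \<in> ball y r. \<forall>z' \<in> ball z r.
       c (x', y') + c (x, z') < c (x, y') + c (x', z')}"

text \<open>Local Metric Twist Condition; the measure of F is the outer measure
  (coincides with the measure whenever F is Borel).\<close>
definition LMTC :: "'a::metric_space measure \<Rightarrow> ('a \<times> 'a \<Rightarrow> ennreal) \<Rightarrow> bool" where
  "LMTC m c \<longleftrightarrow> (\<forall>x y z. y \<noteq> z \<longrightarrow> (\<exists>r1>0. \<exists>r2>0. \<forall>xb \<in> ball x r1.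
      Liminf (at_right 0)
        (\<lambda>s. outer_measure_of m (Fset c s r2 xb y z) / emeasure m (ball xb s)) > 0))"

end

theory Submission
  imports Defs
begin

text \<open>
  Let \<open>\<pi>\<close> be optimal and draw \<open>p\<close>, \<open>q\<close> independently from \<open>\<pi>\<close>. Exchanging the targets of \<open>p\<close> and
  \<open>q\<close> whenever this lowers the cost gives a competitor with the same marginals, so almost surely
  it never does: \<open>\<pi> \<otimes> \<pi>\<close>-almost every pair is \<open>c\<close>-monotone. No cyclically monotone support, and
  hence no duality, is required.

  For \<open>y \<noteq> z\<close> take small closed balls \<open>K1\<close>, \<open>K2\<close> around them, and let \<open>E\<close> be the set of points
  near \<open>x\<close> where both \<open>\<pi>(\<cdot> \<times> K1)\<close> and \<open>\<pi>(\<cdot> \<times> K2)\<close> have positive density with respect to \<open>m\<close>.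
  Monotonicity forces \<open>F(a|y,z) \<inter> E\<close> to be \<open>m\<close>-null for almost all \<open>a \<in> E\<close>, while by the twist
  condition \<open>F(a|y,z)\<close> fills a fixed fraction of small balls around \<open>a\<close>; at a density point of \<open>E\<close>
  this is impossible, so \<open>E\<close> is null. By the Lindelof property countably many triples \<open>(x, y, z)\<close>
  suffice, and \<open>\<pi>\<close> lives on a Borel graph. Uniqueness follows because the average of two optimal
  plans is optimal and therefore lives on a graph as well.
\<close>

section \<open>Separated sets and coverings by balls\<close>

lemma lsc_borel_measurable:
  fixes c :: "'a::topological_space \<Rightarrow> ennreal"
  assumes "lsc c"
  shows "c \<in> borel_measurable borel"
  using assms by (intro borel_measurableI_greater) (simp add: lsc_def borel_open)

text \<open>Zorn's lemma: a point at distance at least \<open>e\<close> from all of \<open>P\<close>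
  could be added to \<open>P\<close>, so a maximal separated set is automatically a net. With
  \<open>e = 2 * s\<close> the balls of radius \<open>s\<close> around \<open>P\<close> are disjoint
  while the doubled balls cover, which is all that is needed from a covering theorem.\<close>

lemma maximal_separated_subset:
  fixes S :: "'a::metric_space set"
  obtains P where "P \<subseteq> S" "\<And>a b. a \<in> P \<Longrightarrow> b \<in> P \<Longrightarrow> a \<noteq> b \<Longrightarrow> e \<le> dist a b"
    "\<And>a. a \<in> S \<Longrightarrow> e > 0 \<Longrightarrow> \<exists>b\<in>P. dist b a < e"
proof -
  define \<A> where "\<A> = {P. P \<subseteq> S \<and> (\<forall>a\<in>P. \<forall>b\<in>P. a \<noteq> b \<longrightarrow> e \<le> dist a b)}"
  have "\<forall>C\<in>chains \<A>. \<Union>C \<in> \<A>"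
  proof
    fix C assume "C \<in> chains \<A>"
    then have sub: "C \<subseteq> \<A>" and ch: "\<And>X Y. X \<in> C \<Longrightarrow> Y \<in> C \<Longrightarrow> X \<subseteq> Y \<or> Y \<subseteq> X"
      by (auto simp: chains_def chain_subset_def)
    have "e \<le> dist a b" if ab: "X \<in> C" "a \<in> X" "Y \<in> C" "b \<in> Y" "a \<noteq> b" for X Y a b
    proof -
      from ch[OF ab(1,3)] consider "{a,b} \<subseteq> X" | "{a,b} \<subseteq> Y" using ab by auto
      then show ?thesis using sub ab unfolding \<A>_def by cases (blast+)
    qed
    with sub show "\<Union>C \<in> \<A>" unfolding \<A>_def by blast
  qed
  from Zorn_Lemma[OF this] obtain P where P: "P \<in> \<A>" "\<And>X. X \<in> \<A> \<Longrightarrow> P \<subseteq> X \<Longrightarrow> X = P"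
    by blast
  show thesis
  proof
    show "P \<subseteq> S" "\<And>a b. a \<in> P \<Longrightarrow> b \<in> P \<Longrightarrow> a \<noteq> b \<Longrightarrow> e \<le> dist a b"
      using P(1) by (auto simp: \<A>_def)
    fix a assume a: "a \<in> S" "e > 0"
    show "\<exists>b\<in>P. dist b a < e"
    proof (rule ccontr)
      assume "\<not> ?thesis"
      then have far: "\<And>b. b \<in> P \<Longrightarrow> e \<le> dist b a" by force
      then have "insert a P \<in> \<A>" using P(1) a by (auto simp: \<A>_def dist_commute)
      then have "a \<in> P" using P(2)[of "insert a P"] by auto
      with far[of a] a show False by simp
    qed
  qed
qed

text \<open>The indicator of a union is at most the sum of the indicators; integrating and
  exchanging sum and integral gives subadditivity without enumerating \<open>I\<close>.\<close>

lemma emeasure_UN_countable_le: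
  assumes X[measurable]: "\<And>i. i \<in> I \<Longrightarrow> X i \<in> sets M" and I: "countable I"
  shows "emeasure M (\<Union>i\<in>I. X i) \<le> (\<integral>\<^sup>+i. emeasure M (X i) \<partial>count_space I)"
proof -
  have "(\<Union>i\<in>I. X i) \<in> sets M" using I X by (intro sets.countable_UN') auto
  then have "emeasure M (\<Union>i\<in>I. X i) = (\<integral>\<^sup>+x. indicator (\<Union>i\<in>I. X i) x \<partial>M)" by simp
  also have "\<dots> \<le> (\<integral>\<^sup>+x. \<integral>\<^sup>+i. indicator (X i) x \<partial>count_space I \<partial>M)"
  proof (rule nn_integral_mono)
    fix x
    show "indicator (\<Union>i\<in>I. X i) x \<le> (\<integral>\<^sup>+i. indicator (X i) x \<partial>count_space I)"
    proof (cases "x \<in> (\<Union>i\<in>I. X i)")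
      case True
      then obtain i where "i \<in> I" "x \<in> X i" by auto
      then show ?thesis
        using nn_integral_ge_point[of i I "\<lambda>i. indicator (X i) x"]
        by (simp add: indicator_simps(1)[OF True] del: UN_iff)
    qed simp
  qed
  also have "\<dots> = (\<integral>\<^sup>+i. emeasure M (X i) \<partial>count_space I)"
    using I by (simp add: nn_integral_count_space_nn_integral cong: nn_integral_cong_simp)
  finally show ?thesis .
qed

text \<open>For a maximal \<open>2 * s\<close>-separated set \<open>P\<close> in \<open>S\<close>,
  the doubled balls cover \<open>S\<close>, doubling returns to the balls of radius
  \<open>s\<close>, and these are disjoint with a fraction \<epsilon> of each lying in
  \<open>U - E\<close>. Summing over \<open>P\<close> gives the bound. Outer measure appears because
  \<open>S\<close> need not be measurable.\<close>

lemma outer_measure_of_covered_by_balls: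
  fixes m :: "'a::{metric_space, second_countable_topology} measure"
  assumes sets: "sets m = sets borel" and "s > 0"
    and dbl: "\<And>a. a \<in> S \<Longrightarrow> emeasure m (ball a (2 * s)) \<le> C * emeasure m (ball a s)"
    and low: "\<And>a. a \<in> S \<Longrightarrow> \<epsilon> * emeasure m (ball a s) \<le> emeasure m (ball a s - E)"
    and sub: "\<And>a. a \<in> S \<Longrightarrow> ball a s \<subseteq> U" and "U \<in> sets borel" "E \<in> sets borel"
  shows "\<epsilon> * outer_measure_of m S \<le> C * emeasure m (U - E)"
proof -
  obtain P where P: "P \<subseteq> S" "\<And>a b. a \<in> P \<Longrightarrow> b \<in> P \<Longrightarrow> a \<noteq> b \<Longrightarrow> 2 * s \<le> dist a b"
    and cov: "\<And>a. a \<in> S \<Longrightarrow> \<exists>b\<in>P. dist b a < 2 * s"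
    using maximal_separated_subset[of S "2 * s"] \<open>s > 0\<close> by (metis mult_pos_pos zero_less_numeral)
  have disj: "ball a s \<inter> ball b s = {}" if "a \<in> P" "b \<in> P" "a \<noteq> b" for a b
  proof -
    have "2 * s \<le> dist a b" using that by (rule P)
    then have False if "dist a z < s" "dist b z < s" for z
      using that dist_triangle2[of a b z] by linarith
    then show ?thesis by auto
  qed
  \<comment> \<open>Disjoint open sets in a second countable space form a countable family, and
    since the balls are also nonempty each of them determines its centre.\<close>
  have "countable ((\<lambda>a. ball a s) ` P)"
  proof (rule countable_disjoint_open_subsets)
    show "pairwise disjnt ((\<lambda>a. ball a s) ` P)"
    proof (rule pairwiseI)
      fix X Y assume "X \<in> (\<lambda>a. ball a s) ` P" "Y \<in> (\<lambda>a. ball a s) ` P" "X \<noteq> Y"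
      then obtain a b where ab: "X = ball a s" "Y = ball b s" "a \<in> P" "b \<in> P" by blast
      with \<open>X \<noteq> Y\<close> have "a \<noteq> b" by metis
      with ab disj show "disjnt X Y" by (simp add: disjnt_def)
    qed
  qed auto
  moreover have "inj_on (\<lambda>a. ball a s) P"
  proof (rule inj_onI, rule ccontr)
    fix a b assume ab: "a \<in> P" "b \<in> P" "ball a s = ball b s" "a \<noteq> b"
    then have "ball a s = {}" using disj[of a b] by simp
    then show False using \<open>s > 0\<close> by simp
  qed
  ultimately have cP: "countable P" by (rule countable_image_inj_on)
  have [measurable]: "U \<in> sets m" "E \<in> sets m" "\<And>a r. ball a r \<in> sets m"
    using sets \<open>U \<in> sets borel\<close> \<open>E \<in> sets borel\<close> by simp_all
  have "outer_measure_of m S \<le> outer_measure_of m (\<Union>b\<in>P. ball b (2 * s))"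
    using cov by (intro outer_measure_of_mono) auto
  also have "\<dots> = emeasure m (\<Union>b\<in>P. ball b (2 * s))"
    using cP by (intro outer_measure_of_eq) auto
  also have "\<dots> \<le> (\<integral>\<^sup>+b. emeasure m (ball b (2 * s)) \<partial>count_space P)"
    using cP by (intro emeasure_UN_countable_le) auto
  finally have "\<epsilon> * outer_measure_of m S \<le> \<epsilon> * (\<integral>\<^sup>+b. emeasure m (ball b (2 * s)) \<partial>count_space P)"
    by (rule mult_left_mono) simp
  also have "\<dots> = (\<integral>\<^sup>+b. \<epsilon> * emeasure m (ball b (2 * s)) \<partial>count_space P)"
    by (simp add: nn_integral_cmult)
  also have "\<dots> \<le> (\<integral>\<^sup>+b. C * emeasure m (ball b s - E) \<partial>count_space P)"
  proof (rule nn_integral_mono)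
    fix b assume "b \<in> space (count_space P)"
    then have b: "b \<in> S" using P by auto
    have "\<epsilon> * emeasure m (ball b (2 * s)) \<le> \<epsilon> * (C * emeasure m (ball b s))"
      by (intro mult_left_mono dbl b) simp
    also have "\<dots> = C * (\<epsilon> * emeasure m (ball b s))" by (simp add: ac_simps)
    also have "\<dots> \<le> C * emeasure m (ball b s - E)"
      by (intro mult_left_mono low b) simp
    finally show "\<epsilon> * emeasure m (ball b (2 * s)) \<le> C * emeasure m (ball b s - E)" .
  qed
  also have "\<dots> = C * (\<integral>\<^sup>+b. emeasure m (ball b s - E) \<partial>count_space P)"
    by (simp add: nn_integral_cmult)
  also have "(\<integral>\<^sup>+b. emeasure m (ball b s - E) \<partial>count_space P) = emeasure m (\<Union>b\<in>P. ball b s - E)"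
  proof (rule emeasure_UN_countable[symmetric])
    show "disjoint_family_on (\<lambda>b. ball b s - E) P"
      unfolding disjoint_family_on_def using disj by blast
  qed (use cP in auto)
  also have "C * \<dots> \<le> C * emeasure m (U - E)"
    using sub P by (intro mult_left_mono emeasure_mono) auto
  finally show ?thesis .
qed

section \<open>Density points of a doubling measure\<close>

text \<open>Restricting \<open>m\<close> to \<open>V\<close> produces a finite measure, for which
  outer regularity is available; the open set found there is then cut down to
  \<open>V\<close>.\<close>

lemma outer_regular_within:
  fixes m :: "'a::{second_countable_topology, complete_space} measure"
  assumes sets: "sets m = sets borel" and E: "E \<in> sets borel" "E \<subseteq> V"
    and V: "open V" "emeasure m V < \<infinity>" and "\<eta> > 0"
  obtains U where "open U" "E \<subseteq> U" "U \<subseteq> V" "emeasure m (U - E) \<le> \<eta>"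
proof -
  have [measurable]: "V \<in> sets m" "E \<in> sets m" using assms by auto
  define M where "M = density m (indicator V)"
  have em: "emeasure M X = emeasure m (X \<inter> V)" if "X \<in> sets borel" for X
    using that sets V(1) emeasure_restricted[of V m X] by (simp add: M_def Int_commute)
  have sM: "sets M = sets borel" by (simp add: M_def sets)
  have fin: "emeasure M X \<noteq> \<infinity>" if "X \<in> sets borel" for X
  proof -
    have "emeasure M X \<le> emeasure m V" unfolding em[OF that] by (rule emeasure_mono) auto
    then show ?thesis using V by auto
  qed
  have "space M \<in> sets borel" using sets.top[of M] sM by simp
  then have reg: "emeasure M E = (INF U \<in> {U. E \<subseteq> U \<and> open U}. emeasure M U)"
    by (intro outer_regular sM fin E)
  have "emeasure M E < emeasure M E + \<eta>"
    using fin[OF E(1)] \<open>\<eta> > 0\<close> by (metis add.right_neutral ennreal_add_left_cancel_less infinity_ennreal_def)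
  then obtain U where U: "E \<subseteq> U" "open U" "emeasure M U < emeasure M E + \<eta>"
    unfolding reg by (auto simp: INF_less_iff)
  have [measurable]: "U \<in> sets M" using U sM by auto
  have "emeasure m (U \<inter> V - E) = emeasure M (U - E)"
    using U E by (subst em) (auto intro!: arg_cong[where f="emeasure m"])
  also have "\<dots> = emeasure M U - emeasure M E"
    using U E fin sM by (intro emeasure_Diff) auto
  also have "\<dots> \<le> \<eta>"
    using U(3) fin[OF E(1)] by (simp add: ennreal_minus_le_iff)
  finally show ?thesis using U V E by (intro that[of "U \<inter> V"]) auto
qed

text \<open>A weak form of the Lebesgue density theorem. The exceptional points split into countably
  many sets \<open>S j\<close> with a uniform lower bound on the missing fraction, and the covering
  estimate bounds the outer measure of each by a multiple of \<open>emeasure m (U - E)\<close>,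
  which outer regularity makes arbitrarily small.\<close>

lemma doubling_density:
  fixes m :: "'a::{second_countable_topology, complete_space} measure"
  assumes sets: "sets m = sets borel" and "doubling m" and E: "E \<in> sets borel" "E \<subseteq> V"
    and V: "open V" "emeasure m V < \<infinity>"
  shows "\<exists>Q\<in>null_sets m. \<forall>a\<in>E - Q.
       \<not> 0 < Liminf (at_right 0) (\<lambda>s. emeasure m (ball a s - E) / emeasure m (ball a s))"
proof -
  obtain C :: real where C: "C > 0"
    and dbl: "\<And>x r. r > 0 \<Longrightarrow> emeasure m (ball x (2 * r)) \<le> ennreal C * emeasure m (ball x r)"
    using \<open>doubling m\<close> by (auto simp: doubling_def)
  have space_m: "space m = UNIV" using sets_eq_imp_space_eq[OF sets] by simp
  define \<epsilon> where "\<epsilon> j = ennreal (1 / real (Suc j))" for j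
  \<comment> \<open>One index \<open>j\<close> governs both the fraction of the ball missing from
    \<open>E\<close> and the scale below which it is missing, so a countable union captures every
    exceptional point.\<close>
  define S where "S j = {a\<in>E. \<forall>s. 0 < s \<and> s < 1 / real (Suc j) \<longrightarrow>
      \<epsilon> j * emeasure m (ball a s) \<le> emeasure m (ball a s - E)}" for j
  have eps: "\<epsilon> j > 0" "\<epsilon> j < \<infinity>" for j by (auto simp: \<epsilon>_def)
  have small: "\<epsilon> j * outer_measure_of m (S j) \<le> ennreal C * \<eta>" if "\<eta> > 0" for j \<eta>
  proof -
    obtain U where U: "open U" "E \<subseteq> U" "U \<subseteq> V" "emeasure m (U - E) \<le> \<eta>"
      using outer_regular_within[OF sets E V \<open>\<eta> > 0\<close>] by metis
    \<comment> \<open>On \<open>R n\<close> one radius serves all points, so a maximal separated set replaces a Vitali cover.\<close>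
    define R where "R n = {a \<in> S j. ball a (1 / real (Suc n)) \<subseteq> U}" for n
    have "incseq R"
    proof (rule incseq_SucI)
      fix n
      have "ball a (1 / real (Suc (Suc n))) \<subseteq> ball a (1 / real (Suc n))" for a
        by (intro subset_ball) (simp add: field_simps)
      then show "R n \<le> R (Suc n)" unfolding R_def by blast
    qed
    have "(\<Union>n. R n) = S j"
    proof (intro subset_antisym subsetI)
      fix a assume a: "a \<in> S j"
      then have "a \<in> U" using U by (auto simp: S_def)
      then obtain e where e: "e > 0" "ball a e \<subseteq> U" using U(1) open_contains_ball by blast
      then obtain n where "1 / real (Suc n) < e" using nat_approx_posE by blast
      then have "ball a (1 / real (Suc n)) \<subseteq> ball a e" by (intro subset_ball) simp
      with a e(2) show "a \<in> (\<Union>n. R n)" unfolding R_def by blast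
    qed (auto simp: R_def)
    \<comment> \<open>Outer measure is continuous along increasing sequences of arbitrary sets, so
      measurability of \<open>R n\<close> is not an issue.\<close>
    then have "outer_measure_of m (S j) = (SUP n. outer_measure_of m (R n))"
      using SUP_outer_measure_of_incseq[OF _ \<open>incseq R\<close>, of m] space_m by simp
    then have "\<epsilon> j * outer_measure_of m (S j) = (SUP n. \<epsilon> j * outer_measure_of m (R n))"
      by (simp add: SUP_mult_left_ennreal)
    also have "\<dots> \<le> ennreal C * \<eta>"
    proof (rule SUP_least)
      fix n
      \<comment> \<open>The additional factor \<open>1 / 2\<close> makes
        \<open>s < 1 / real (Suc j)\<close> strict, as the definition of \<open>S j\<close>
        demands.\<close>
      define s where "s = min (1 / real (Suc n)) (1 / real (Suc j) / 2)"
      have s: "s > 0" "s \<le> 1 / real (Suc n)" "s < 1 / real (Suc j)"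
        by (auto simp: s_def min_less_iff_disj field_simps)
      have "\<epsilon> j * outer_measure_of m (R n) \<le> ennreal C * emeasure m (U - E)"
      proof (rule outer_measure_of_covered_by_balls[OF sets s(1)])
        fix a assume a: "a \<in> R n"
        show "emeasure m (ball a (2 * s)) \<le> ennreal C * emeasure m (ball a s)" by (rule dbl[OF s(1)])
        show "\<epsilon> j * emeasure m (ball a s) \<le> emeasure m (ball a s - E)"
          using a s by (auto simp: R_def S_def)
        show "ball a s \<subseteq> U" using a s(2) subset_ball[OF s(2), of a] by (auto simp: R_def)
      qed (use U E in auto)
      also have "\<dots> \<le> ennreal C * \<eta>" using U by (intro mult_left_mono) auto
      finally show "\<epsilon> j * outer_measure_of m (R n) \<le> ennreal C * \<eta>" .
    qed
    finally show ?thesis .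
  qed
  have null: "outer_measure_of m (S j) = 0" for j
  proof -
    \<comment> \<open>Taking \<eta> to be \<open>e / C\<close> cancels the doubling
      constant.\<close>
    have "\<epsilon> j * outer_measure_of m (S j) \<le> 0 + ennreal e" if "e > 0" for e
      using small[of "ennreal (e / C)" j] that C by (simp add: ennreal_mult[symmetric])
    then have "\<epsilon> j * outer_measure_of m (S j) \<le> 0" by (rule ennreal_le_epsilon)
    then show ?thesis using eps[of j] by auto
  qed
  have "\<exists>N. N \<in> null_sets m \<and> S j \<subseteq> N" for j
    using outer_measure_of_attain[of "S j" m] null[of j] space_m by auto
  then obtain N where N: "\<And>j. N j \<in> null_sets m" "\<And>j. S j \<subseteq> N j" by metis
  show ?thesis
  proof (intro bexI ballI)
    show "(\<Union>j. N j) \<in> null_sets m" using N by auto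
    fix a assume a: "a \<in> E - (\<Union>j. N j)"
    show "\<not> 0 < Liminf (at_right 0) (\<lambda>s. emeasure m (ball a s - E) / emeasure m (ball a s))"
      (is "\<not> 0 < ?L")
    proof
      assume "0 < ?L"
      then obtain t where t: "0 < t" "t < ?L" using dense by blast
      then have "eventually (\<lambda>s. t < emeasure m (ball a s - E) / emeasure m (ball a s)) (at_right 0)"
        using le_Liminf_iff[of ?L, THEN iffD1, OF order_refl] by blast
      then obtain d where d: "d > 0"
        "\<And>s. 0 < s \<Longrightarrow> s < d \<Longrightarrow> t < emeasure m (ball a s - E) / emeasure m (ball a s)"
        by (auto simp: eventually_at_right_field)
      \<comment> \<open>Since \<open>t\<close> may be infinite, a positive real below it is chosen
        for comparison with \<open>1 / real (Suc j)\<close>.\<close>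
      obtain u where u: "u > 0" "ennreal u < t"
      proof (cases t)
        case (real x)
        then show thesis using t(1) by (intro that[of "x / 2"]) (auto simp: ennreal_less_iff)
      qed (auto intro: that[of 1])
      obtain j where j: "1 / real (Suc j) < min d u" using nat_approx_posE[of "min d u"] d u by auto
      have "a \<in> S j"
        unfolding S_def
      proof (intro CollectI conjI allI impI)
        show "a \<in> E" using a by auto
        fix s assume s: "0 < s \<and> s < 1 / real (Suc j)"
        then have lt: "t < emeasure m (ball a s - E) / emeasure m (ball a s)" using d j by auto
        have "\<epsilon> j \<le> t" using j u by (auto simp: \<epsilon>_def intro!: order.trans[OF _ less_imp_le[OF u(2)]] ennreal_leI)
        show "\<epsilon> j * emeasure m (ball a s) \<le> emeasure m (ball a s - E)"
        proof -
          \<comment> \<open>For a null ball the inequality is trivial, and a ball of infinite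
            measure would make the quotient zero, against \<open>lt\<close>. Only in the remaining
            case can the denominator be cancelled.\<close>
          consider "emeasure m (ball a s) = 0" | "emeasure m (ball a s) = \<top>"
            | "emeasure m (ball a s) \<noteq> 0" "emeasure m (ball a s) \<noteq> \<top>" by blast
          then show ?thesis
          proof cases
            case 3
            have "\<epsilon> j * emeasure m (ball a s) \<le>
                emeasure m (ball a s - E) / emeasure m (ball a s) * emeasure m (ball a s)"
              using lt \<open>\<epsilon> j \<le> t\<close> by (intro mult_right_mono) auto
            also have "\<dots> = emeasure m (ball a s - E)"
              using 3 by (simp add: ennreal_divide_times ennreal_divide_self top.not_eq_extremum)
            finally show ?thesis .
          qed (use lt in auto)
        qed
      qed
      with N a show False by auto
    qed
  qed
qed

section \<open>Pairwise monotonicity by random exchange\<close>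

text \<open>The two pairs drawn are exchangeable, so keeping only the first one after the exchange
  still records half of the expected saving. Finiteness of the optimal cost turns a saving on a set
  of positive measure into a strict decrease, contradicting optimality.\<close>

lemma optimal_plan_swap_AE:
  fixes c :: "'a::polish_space \<times> 'a \<Rightarrow> ennreal"
  assumes c[measurable]: "c \<in> borel_measurable borel" and opt: "\<pi> \<in> OptPlans c \<mu> \<nu>"
  shows "AE p in \<pi>. AE q in \<pi>. c p + c q \<le> c (fst p, snd q) + c (fst q, snd p)"
proof -
  have sets_\<pi>[measurable_cong]: "sets \<pi> = sets borel" and "prob_space \<pi>"
    and marg: "distr \<pi> borel fst = \<mu>" "distr \<pi> borel snd = \<nu>"
    and fin: "(\<integral>\<^sup>+p. c p \<partial>\<pi>) < \<infinity>"
    and min: "\<And>\<pi>'. \<pi>' \<in> Adm \<mu> \<nu> \<Longrightarrow> (\<integral>\<^sup>+p. c p \<partial>\<pi>) \<le> (\<integral>\<^sup>+p. c p \<partial>\<pi>')"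
    using opt by (auto simp: OptPlans_def Adm_def)
  interpret prob_space \<pi> by fact
  interpret PP: pair_prob_space \<pi> \<pi> ..
  have [measurable]: "fst \<in> borel \<rightarrow>\<^sub>M (borel::'a measure)" "snd \<in> borel \<rightarrow>\<^sub>M (borel::'a measure)"
    by (simp_all add: borel_measurable_continuous_onI continuous_on_fst continuous_on_snd continuous_on_id)
  let ?PP = "\<pi> \<Otimes>\<^sub>M \<pi>"
  define x where "x w = (fst (fst w), snd (snd w))" for w :: "('a \<times> 'a) \<times> ('a \<times> 'a)"
  define x' where "x' w = (fst (snd w), snd (fst w))" for w :: "('a \<times> 'a) \<times> ('a \<times> 'a)"
  define A where "A w \<longleftrightarrow> c (x w) + c (x' w) < c (fst w) + c (snd w)" for w
  define sw where "sw = (\<lambda>(p, q). (q, p) :: ('a \<times> 'a) \<times> ('a \<times> 'a))"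
  have [measurable]: "x \<in> ?PP \<rightarrow>\<^sub>M borel" "x' \<in> ?PP \<rightarrow>\<^sub>M borel" "sw \<in> ?PP \<rightarrow>\<^sub>M ?PP"
    unfolding x_def x'_def sw_def by measurable
  have [measurable]: "fst \<in> ?PP \<rightarrow>\<^sub>M borel" "snd \<in> ?PP \<rightarrow>\<^sub>M borel"
    by measurable
  have [measurable]: "Measurable.pred ?PP A" unfolding A_def by measurable
  have swap: "(\<integral>\<^sup>+w. f (sw w) \<partial>?PP) = (\<integral>\<^sup>+w. f w \<partial>?PP)" if [measurable]: "f \<in> borel_measurable ?PP" for f
  proof -
    have "(\<integral>\<^sup>+w. f w \<partial>?PP) = (\<integral>\<^sup>+w. f w \<partial>distr ?PP ?PP sw)"
      using PP.distr_pair_swap by (simp add: sw_def)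
    then show ?thesis by (simp add: nn_integral_distr)
  qed
  have sw_simps: "x (sw w) = x' w" "x' (sw w) = x w" "fst (sw w) = snd w" "snd (sw w) = fst w"
    "A (sw w) \<longleftrightarrow> A w" for w
    by (auto simp: sw_def x_def x'_def A_def add.commute split: prod.splits)
  have fst_PP: "(\<integral>\<^sup>+w. f (fst w) \<partial>?PP) = (\<integral>\<^sup>+p. f p \<partial>\<pi>)" if [measurable]: "f \<in> borel_measurable borel" for f
    by (subst nn_integral_fst[symmetric]) (auto simp: emeasure_space_1)
  \<comment> \<open>The competitor is the law of \<open>h\<close>; symmetry of \<open>A\<close> under \<open>sw\<close> preserves the second marginal.\<close>
  define h where "h w = (if A w then x w else fst w)" for w
  have [measurable]: "h \<in> ?PP \<rightarrow>\<^sub>M borel" unfolding h_def by measurable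
  define \<pi>' where "\<pi>' = distr ?PP borel h"
  have "\<pi>' \<in> Adm \<mu> \<nu>"
    unfolding Adm_def
  proof (intro CollectI conjI)
    show "prob_space \<pi>'" unfolding \<pi>'_def by (rule PP.prob_space_distr) measurable
    show "sets \<pi>' = sets borel" by (simp add: \<pi>'_def)
    show "distr \<pi>' borel fst = \<mu>"
    proof (rule measure_eqI)
      show "sets (distr \<pi>' borel fst) = sets \<mu>" using marg by auto
      fix W assume "W \<in> sets (distr \<pi>' borel fst)"
      then have [measurable]: "W \<in> sets borel" by simp
      have "emeasure (distr \<pi>' borel fst) W = (\<integral>\<^sup>+w. indicator W (fst (h w)) \<partial>?PP)"
        by (simp add: \<pi>'_def distr_distr nn_integral_distr flip: nn_integral_indicator)
      also have "\<dots> = (\<integral>\<^sup>+w. indicator W (fst (fst w)) \<partial>?PP)"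
        by (simp add: h_def x_def if_distrib cong: if_cong)
      also have "\<dots> = (\<integral>\<^sup>+p. indicator W (fst p) \<partial>\<pi>)"
        by (rule fst_PP) measurable
      also have "\<dots> = emeasure \<mu> W"
        unfolding marg(1)[symmetric] by (simp add: nn_integral_distr flip: nn_integral_indicator)
      finally show "emeasure (distr \<pi>' borel fst) W = emeasure \<mu> W" .
    qed
    show "distr \<pi>' borel snd = \<nu>"
    proof (rule measure_eqI)
      show "sets (distr \<pi>' borel snd) = sets \<nu>" using marg by auto
      fix W assume "W \<in> sets (distr \<pi>' borel snd)"
      then have [measurable]: "W \<in> sets borel" by simp
      have "emeasure (distr \<pi>' borel snd) W = (\<integral>\<^sup>+w. indicator W (snd (h w)) \<partial>?PP)"
        by (simp add: \<pi>'_def distr_distr nn_integral_distr flip: nn_integral_indicator)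
      also have "\<dots> = (\<integral>\<^sup>+w. indicator W (snd (snd w)) * indicator {w. A w} w
          + indicator W (snd (fst w)) * indicator {w. \<not> A w} w \<partial>?PP)"
        by (intro nn_integral_cong) (simp add: h_def x_def)
      also have "\<dots> = (\<integral>\<^sup>+w. indicator W (snd (snd w)) * indicator {w. A w} w \<partial>?PP)
          + (\<integral>\<^sup>+w. indicator W (snd (fst w)) * indicator {w. \<not> A w} w \<partial>?PP)"
        by (rule nn_integral_add) measurable
      also have "(\<integral>\<^sup>+w. indicator W (snd (snd w)) * indicator {w. A w} w \<partial>?PP)
          = (\<integral>\<^sup>+w. indicator W (snd (fst w)) * indicator {w. A w} w \<partial>?PP)"
        by (subst swap[symmetric]) (simp_all add: sw_simps indicator_def)
      also have "\<dots> + (\<integral>\<^sup>+w. indicator W (snd (fst w)) * indicator {w. \<not> A w} w \<partial>?PP)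
          = (\<integral>\<^sup>+w. indicator W (snd (fst w)) * indicator {w. A w} w
            + indicator W (snd (fst w)) * indicator {w. \<not> A w} w \<partial>?PP)"
        by (rule nn_integral_add[symmetric]) measurable
      also have "\<dots> = (\<integral>\<^sup>+w. indicator W (snd (fst w)) \<partial>?PP)"
        by (intro nn_integral_cong) (simp add: indicator_def)
      also have "\<dots> = (\<integral>\<^sup>+p. indicator W (snd p) \<partial>\<pi>)"
        by (rule fst_PP) measurable
      also have "\<dots> = emeasure \<nu> W"
        unfolding marg(2)[symmetric] by (simp add: nn_integral_distr flip: nn_integral_indicator)
      finally show "emeasure (distr \<pi>' borel snd) W = emeasure \<nu> W" .
    qed
  qed
  define I where "I f = (\<integral>\<^sup>+w. c (f w) * indicator {w. A w} w \<partial>?PP)" for f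
  define J where "J = (\<integral>\<^sup>+w. c (fst w) * indicator {w. \<not> A w} w \<partial>?PP)"
  have cost: "(\<integral>\<^sup>+p. c p \<partial>\<pi>) = I fst + J"
  proof -
    have "(\<integral>\<^sup>+p. c p \<partial>\<pi>) = (\<integral>\<^sup>+w. c (fst w) \<partial>?PP)" by (rule fst_PP[symmetric]) measurable
    also have "\<dots> = (\<integral>\<^sup>+w. c (fst w) * indicator {w. A w} w + c (fst w) * indicator {w. \<not> A w} w \<partial>?PP)"
      by (intro nn_integral_cong) (simp add: indicator_def)
    also have "\<dots> = I fst + J" unfolding I_def J_def by (rule nn_integral_add) measurable
    finally show ?thesis .
  qed
  have "(\<integral>\<^sup>+p. c p \<partial>\<pi>') = (\<integral>\<^sup>+w. c (h w) \<partial>?PP)" by (simp add: \<pi>'_def nn_integral_distr)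
  also have "\<dots> = (\<integral>\<^sup>+w. c (x w) * indicator {w. A w} w + c (fst w) * indicator {w. \<not> A w} w \<partial>?PP)"
    by (intro nn_integral_cong) (simp add: h_def indicator_def)
  also have "\<dots> = I x + J" unfolding I_def J_def by (rule nn_integral_add) measurable
  finally have "I fst + J \<le> I x + J" using min[OF \<open>\<pi>' \<in> Adm \<mu> \<nu>\<close>] cost by simp
  moreover have fin_I: "I fst < \<infinity>" "J < \<infinity>" using fin unfolding cost by auto
  \<comment> \<open>The part \<open>J\<close> of the cost where nothing is exchanged is finite and
    cancels.\<close>
  ultimately have le: "I fst \<le> I x"
    by (metis add.commute ennreal_add_left_cancel_le infinity_ennreal_def less_irrefl)
  have sym: "I snd = I fst" "I x' = I x"
    unfolding I_def by (subst swap[symmetric]; simp add: sw_simps indicator_def)+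
  have sum: "(\<integral>\<^sup>+w. (c (f w) + c (g w)) * indicator {w. A w} w \<partial>?PP) = I f + I g"
    if [measurable]: "f \<in> ?PP \<rightarrow>\<^sub>M borel" "g \<in> ?PP \<rightarrow>\<^sub>M borel" for f g
    unfolding I_def distrib_right by (rule nn_integral_add) measurable
  have "AE w in ?PP. \<not> A w"
  proof (rule ccontr)
    assume not: "\<not> (AE w in ?PP. \<not> A w)"
    let ?f = "\<lambda>w. (c (x w) + c (x' w)) * indicator {w. A w} w"
    let ?g = "\<lambda>w. (c (fst w) + c (snd w)) * indicator {w. A w} w"
    have fg: "AE w in ?PP. ?f w \<le> ?g w" by (auto simp: indicator_def A_def)
    have "integral\<^sup>N ?PP ?f \<le> integral\<^sup>N ?PP ?g" by (rule nn_integral_mono_AE[OF fg])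
    also have "\<dots> < \<infinity>" using fin_I by (simp add: sum sym)
    finally have "integral\<^sup>N ?PP ?f \<noteq> \<infinity>" by simp
    \<comment> \<open>On \<open>A\<close> the inequality \<open>?f w < ?g w\<close> is strict, so
      the reverse inequality almost everywhere would make \<open>A\<close> null. The resulting
      strict inequality of integrals is twice the comparison of \<open>I x\<close> with
      \<open>I fst\<close>, by the symmetry \<open>sym\<close>.\<close>
    moreover have "\<not> (AE w in ?PP. ?g w \<le> ?f w)"
    proof
      assume "AE w in ?PP. ?g w \<le> ?f w"
      then have "AE w in ?PP. \<not> A w" by eventually_elim (auto simp: indicator_def A_def split: if_splits)
      with not show False by simp
    qed
    ultimately have "integral\<^sup>N ?PP ?f < integral\<^sup>N ?PP ?g"
      by (intro nn_integral_less fg) measurable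
    then have "I x + I x < I fst + I fst" by (simp add: sum sym)
    with add_mono[OF le le] show False by simp
  qed
  then have "AE p in \<pi>. AE q in \<pi>. \<not> A (p, q)" by (rule PP.AE_pair)
  then show ?thesis by (simp add: A_def x_def x'_def not_less)
qed

section \<open>Null tubes and densities of slices\<close>

text \<open>
  The set \<open>S\<close> may fail to be measurable, which is why sections cannot be used; compactness of \<open>K\<close>
  lets open neighbourhoods of \<open>N\<close> absorb whole tubes instead.
\<close>

lemma null_set_tube:
  fixes \<pi> :: "('a::polish_space \<times> 'b::polish_space) measure"
  assumes sets: "sets \<pi> = sets borel" and "finite_measure \<pi>" and N: "N \<in> null_sets \<pi>"
    and K: "compact K" and S: "S \<times> K \<subseteq> N"
  obtains Z where "Z \<in> sets borel" "S \<subseteq> Z" "emeasure \<pi> (Z \<times> K) = 0"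
proof -
  interpret finite_measure \<pi> by fact
  have "\<exists>V. open V \<and> S \<subseteq> V \<and> emeasure \<pi> (V \<times> K) < ennreal (1 / real (Suc n))" for n
  proof -
    have "emeasure \<pi> N = (INF U \<in> {U. N \<subseteq> U \<and> open U}. emeasure \<pi> U)"
      by (rule outer_regular[OF sets]) (use N sets in auto)
    then have "(INF U \<in> {U. N \<subseteq> U \<and> open U}. emeasure \<pi> U) < ennreal (1 / real (Suc n))"
      using N by (simp add: null_setsD1)
    then obtain U where U: "N \<subseteq> U" "open U" "emeasure \<pi> U < ennreal (1 / real (Suc n))"
      by (auto simp: INF_less_iff)
    have "\<exists>V. a \<in> V \<and> open V \<and> V \<times> K \<subseteq> U" if "a \<in> S" for a
      using that S U by (intro Elementary_Topology.tube_lemma K) auto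
    then obtain V where V: "\<And>a. a \<in> S \<Longrightarrow> a \<in> V a \<and> open (V a) \<and> V a \<times> K \<subseteq> U" by metis
    have "emeasure \<pi> ((\<Union>a\<in>S. V a) \<times> K) \<le> emeasure \<pi> U"
      using V U sets by (intro emeasure_mono) auto
    with U V show ?thesis by (intro exI[of _ "\<Union>a\<in>S. V a"]) auto
  qed
  then obtain V where V: "\<And>n. open (V n)" "\<And>n. S \<subseteq> V n"
    "\<And>n. emeasure \<pi> (V n \<times> K) < ennreal (1 / real (Suc n))" by metis
  show thesis
  proof
    show "(\<Inter>n. V n) \<in> sets borel" using V(1) by (intro sets.countable_INT) auto
    show "S \<subseteq> (\<Inter>n. V n)" using V by auto
    have "emeasure \<pi> ((\<Inter>n. V n) \<times> K) \<le> 0 + ennreal e" if "e > 0" for e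
    proof -
      obtain n where n: "1 / real (Suc n) < e" using nat_approx_posE[OF \<open>e > 0\<close>] by blast
      have "V n \<times> K \<in> sets borel"
        by (intro borel_Times borel_open borel_compact V K)
      then have "emeasure \<pi> ((\<Inter>n. V n) \<times> K) \<le> emeasure \<pi> (V n \<times> K)"
        using sets by (intro emeasure_mono) auto
      also have "\<dots> \<le> ennreal e" using less_imp_le[OF V(3)[of n]] ennreal_leI[OF less_imp_le[OF n]] by (rule order.trans)
      finally show ?thesis by simp
    qed
    then have "emeasure \<pi> ((\<Inter>n. V n) \<times> K) \<le> 0" by (rule ennreal_le_epsilon)
    then show "emeasure \<pi> ((\<Inter>n. V n) \<times> K) = 0" by simp
  qed
qed

lemma proper_emeasure_ball_finite:
  fixes m :: "'a::metric_space measure"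
  assumes "proper_space TYPE('a)" and "locally_finite_borel m"
  shows "emeasure m (ball x r) < \<infinity>"
proof -
  have sets: "sets m = sets borel" and "\<exists>\<rho>. \<forall>y. \<rho> y > 0 \<and> emeasure m (ball y (\<rho> y)) < \<infinity>"
    using assms(2) by (auto simp: locally_finite_borel_def intro: choice)
  then obtain \<rho> where \<rho>: "\<And>y. \<rho> y > 0" "\<And>y. emeasure m (ball y (\<rho> y)) < \<infinity>" by blast
  have "compact (cball x r)" using assms(1) by (auto simp: proper_space_def)
  moreover have "cball x r \<subseteq> (\<Union>y\<in>cball x r. ball y (\<rho> y))" using \<rho>(1) by force
  ultimately obtain F where F: "F \<subseteq> cball x r" "finite F" "cball x r \<subseteq> (\<Union>y\<in>F. ball y (\<rho> y))"
    by (elim compactE_image) auto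
  have "emeasure m (ball x r) \<le> emeasure m (\<Union>y\<in>F. ball y (\<rho> y))"
    using F sets ball_subset_cball[of x r] by (intro emeasure_mono) auto
  also have "\<dots> \<le> (\<Sum>y\<in>F. emeasure m (ball y (\<rho> y)))"
    using F sets by (intro emeasure_subadditive_finite) auto
  also have "\<dots> < \<infinity>" using F \<rho>(2) by (simp add: less_top)
  finally show ?thesis .
qed

lemma sigma_finite_measure_if_balls_finite:
  fixes m :: "'a::metric_space measure"
  assumes sets: "sets m = sets borel" and fin: "\<And>x r. emeasure m (ball x r) < \<infinity>"
  shows "sigma_finite_measure m"
proof
  fix x :: 'a
  have "(\<Union>n::nat. ball x (real n)) = UNIV"
    by (auto simp: reals_Archimedean2)
  then show "\<exists>A. countable A \<and> A \<subseteq> sets m \<and> \<Union> A = space m \<and> (\<forall>a\<in>A. emeasure m a \<noteq> \<infinity>)"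
    using sets sets_eq_imp_space_eq[OF sets] fin
    by (intro exI[of _ "range (\<lambda>n::nat. ball x (real n))"]) (auto simp: less_top[symmetric])
qed

text \<open>The part of \<pi> with target in \<open>K\<close> has a first marginal dominated by that
  of \<pi>, hence absolutely continuous; \<open>g\<close> is its Radon-Nikodym derivative.\<close>

lemma plan_slice_density:
  fixes m :: "'a::second_countable_topology measure"
    and \<pi> :: "('a \<times> 'b::second_countable_topology) measure"
  assumes "sigma_finite_measure m" and sets: "sets m = sets borel" and sets_\<pi>: "sets \<pi> = sets borel"
    and ac: "absolutely_continuous m (distr \<pi> borel fst)" and K: "K \<in> sets borel"
  shows "\<exists>g\<in>borel_measurable borel. \<forall>W\<in>sets borel.
    emeasure \<pi> (W \<times> K) = (\<integral>\<^sup>+x. g x * indicator W x \<partial>m)"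
proof -
  interpret sigma_finite_measure m by fact
  have space_\<pi>: "space \<pi> = UNIV" using sets_eq_imp_space_eq[OF sets_\<pi>] by simp
  have fst_meas: "fst \<in> \<pi> \<rightarrow>\<^sub>M borel"
    unfolding measurable_cong_sets[OF sets_\<pi> refl]
    by (simp add: borel_measurable_continuous_onI continuous_on_fst continuous_on_id)
  have UK: "UNIV \<times> K \<in> sets \<pi>" using K sets_\<pi> by (simp add: borel_Times)
  define N where "N = distr (density \<pi> (indicator (UNIV \<times> K))) borel fst"
  have em: "emeasure N W = emeasure \<pi> (W \<times> K)" if W: "W \<in> sets borel" for W
  proof -
    have "fst -` W \<inter> space \<pi> \<in> sets \<pi>" using measurable_sets[OF fst_meas W] .
    then have "emeasure N W = emeasure \<pi> ((UNIV \<times> K) \<inter> fst -` W)"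
      using W UK fst_meas space_\<pi> unfolding N_def by (subst emeasure_distr) (auto simp: emeasure_restricted)
    also have "(UNIV \<times> K) \<inter> fst -` W = W \<times> K" by auto
    finally show ?thesis .
  qed
  have "absolutely_continuous m N"
    unfolding absolutely_continuous_def
  proof
    fix W assume W: "W \<in> null_sets m"
    then have Wb: "W \<in> sets borel" using sets by auto
    have "emeasure (distr \<pi> borel fst) W = 0" using ac W by (auto simp: absolutely_continuous_def)
    then have "emeasure \<pi> (fst -` W \<inter> space \<pi>) = 0" using fst_meas Wb by (simp add: emeasure_distr)
    moreover have "emeasure \<pi> (W \<times> K) \<le> emeasure \<pi> (fst -` W \<inter> space \<pi>)"
      using measurable_sets[OF fst_meas Wb] space_\<pi> by (intro emeasure_mono) auto
    ultimately show "W \<in> null_sets N" using em[OF Wb] Wb by (auto simp: N_def)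
  qed
  then obtain g where g: "g \<in> borel_measurable m" "density m g = N"
    using Radon_Nikodym[of N] sets by (auto simp: N_def)
  show ?thesis
  proof (intro bexI ballI)
    show "g \<in> borel_measurable borel" using g(1) measurable_cong_sets[OF sets refl] by auto
    show "emeasure \<pi> (W \<times> K) = (\<integral>\<^sup>+x. g x * indicator W x \<partial>m)" if "W \<in> sets borel" for W
      using em[OF that] g emeasure_density[OF g(1), of W] sets that by simp
  qed
qed

section \<open>From graphs to maps\<close>

lemma functional_borel_set_map:
  fixes \<pi> :: "('a::polish_space \<times> 'b::polish_space) measure"
  assumes "finite_measure \<pi>" and sets: "sets \<pi> = sets borel" and \<Gamma>: "\<Gamma> \<in> sets borel" and full: "AE p in \<pi>. p \<in> \<Gamma>"
    and fn: "\<And>x y z. (x, y) \<in> \<Gamma> \<Longrightarrow> (x, z) \<in> \<Gamma> \<Longrightarrow> y = z"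
  obtains T where "T \<in> borel_measurable borel" "AE p in \<pi>. snd p = T (fst p)"
proof -
  interpret finite_measure \<pi> by fact
  \<comment> \<open>On a countable union of compact sets preimages under the map are projections of compact sets,
    so no measurable selection is required.\<close>
  let ?C = "{K. K \<subseteq> \<Gamma> \<and> compact K}"
  have "emeasure \<pi> \<Gamma> = (SUP K\<in>?C. emeasure \<pi> K)"
    by (rule inner_regular[OF sets]) (use \<Gamma> in auto)
  moreover obtain f :: "nat \<Rightarrow> ennreal" where f: "range f \<subseteq> emeasure \<pi> ` ?C"
    "(SUP K\<in>?C. emeasure \<pi> K) = Sup (range f)"
  proof -
    have "?C \<noteq> {}" using compact_empty by blast
    from ennreal_SUP_countable_SUP[OF this, of "emeasure \<pi>"] show thesis using that by blast
  qed
  ultimately have sup: "emeasure \<pi> \<Gamma> = (SUP n. f n)" by simp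
  have "\<exists>K. K \<subseteq> \<Gamma> \<and> compact K \<and> f n = emeasure \<pi> K" for n using f(1) by blast
  then obtain K where K: "\<And>n. K n \<subseteq> \<Gamma>" "\<And>n. compact (K n)" "\<And>n. f n = emeasure \<pi> (K n)" by metis
  define L where "L = (\<Union>n. K n)"
  have Lm: "L \<in> sets \<pi>" unfolding L_def sets using K(2) borel_compact by (intro sets.countable_UN) blast
  have L\<Gamma>: "L \<subseteq> \<Gamma>" using K(1) by (auto simp: L_def)
  have "emeasure \<pi> (\<Gamma> - L) = 0"
  proof -
    have "emeasure \<pi> \<Gamma> \<le> emeasure \<pi> L"
      unfolding sup K(3) using Lm by (intro SUP_least emeasure_mono) (auto simp: L_def)
    moreover have "emeasure \<pi> (\<Gamma> - L) = emeasure \<pi> \<Gamma> - emeasure \<pi> L"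
      using Lm L\<Gamma> \<Gamma> sets by (intro emeasure_Diff) auto
    ultimately show ?thesis by (simp add: diff_eq_0_ennreal less_top[symmetric])
  qed
  then have "AE p in \<pi>. p \<notin> \<Gamma> - L"
    using Lm \<Gamma> sets by (intro AE_not_in) (auto simp: null_sets_def)
  with full have full_L: "AE p in \<pi>. p \<in> L" by eventually_elim auto
  define y0 :: 'b where "y0 = undefined"
  define T where "T x = (if \<exists>y. (x, y) \<in> L then THE y. (x, y) \<in> L else y0)" for x
  have T_eq: "T x = y" if "(x, y) \<in> L" for x y
    using that fn L\<Gamma> unfolding T_def by (auto intro!: the_equality)
  have T_def': "T x = y0" if "x \<notin> fst ` L" for x
    using that unfolding T_def by (force simp: image_iff)
  have fst_compact: "fst ` K' \<in> sets borel" if "compact K'" for K' :: "('a \<times> 'b) set"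
    using that by (intro borel_compact compact_continuous_image continuous_intros)
  have fst_L: "fst ` L \<in> sets borel"
    unfolding L_def image_UN using fst_compact K(2) by (intro sets.countable_UN) auto
  have "T -` S \<in> sets borel" if S: "closed S" for S
  proof -
    have "(\<Union>n. fst ` (K n \<inter> (UNIV \<times> S))) \<in> sets borel"
      using K(2) S by (intro sets.countable_UN image_subsetI fst_compact compact_Int_closed closed_Times) auto
    moreover have "T -` S = (\<Union>n. fst ` (K n \<inter> (UNIV \<times> S))) \<union> (if y0 \<in> S then - fst ` L else {})"
      (is "_ = ?R")
    proof (intro set_eqI iffI)
      fix x assume x: "x \<in> T -` S"
      show "x \<in> ?R"
      proof (cases "x \<in> fst ` L")
        case True
        then obtain y n where "(x, y) \<in> K n" "(x, y) \<in> L" unfolding L_def by force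
        then have "(x, y) \<in> K n \<inter> (UNIV \<times> S)" using x T_eq by auto
        then have "x \<in> fst ` (K n \<inter> (UNIV \<times> S))" by (intro image_eqI[of _ _ "(x, y)"]) simp_all
        then show ?thesis by blast
      next
        case False
        then show ?thesis using x T_def' by auto
      qed
    next
      fix x assume "x \<in> ?R"
      then consider y n where "(x, y) \<in> K n" "y \<in> S" | "x \<notin> fst ` L" "y0 \<in> S"
        by (auto split: if_splits)
      then show "x \<in> T -` S"
      proof cases
        case 1
        then show ?thesis using T_eq[of x y] by (auto simp: L_def)
      qed (simp add: T_def')
    qed
    ultimately show ?thesis using fst_L by auto
  qed
  then have "T \<in> borel_measurable borel" unfolding borel_eq_closed by (intro measurable_measure_of) auto
  moreover have "AE p in \<pi>. snd p = T (fst p)" using full_L by eventually_elim (auto simp: T_eq)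
  ultimately show thesis by (rule that)
qed

text \<open>The identity agrees \<pi>-almost everywhere with the map sending \<open>p\<close> to
  \<open>(fst p, T (fst p))\<close>, and the law of the latter depends only on the first
  marginal.\<close>

lemma plan_eq_distr_graph:
  fixes \<pi> :: "('a::polish_space \<times> 'a) measure"
  assumes \<pi>: "\<pi> \<in> Adm \<mu> \<nu>" and T: "T \<in> borel_measurable borel" and graph: "AE p in \<pi>. snd p = T (fst p)"
  shows "\<pi> = distr \<mu> borel (\<lambda>x. (x, T x))"
proof -
  have sets: "sets \<pi> = sets borel" and marg: "distr \<pi> borel fst = \<mu>" using \<pi> by (auto simp: Adm_def)
  have [measurable]: "fst \<in> \<pi> \<rightarrow>\<^sub>M borel"
    unfolding measurable_cong_sets[OF sets refl]
    by (simp add: borel_measurable_continuous_onI continuous_on_fst continuous_on_id)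
  note [measurable] = T
  have "distr \<mu> borel (\<lambda>x. (x, T x)) = distr \<pi> borel (\<lambda>p. (fst p, T (fst p)))"
    unfolding marg[symmetric] by (subst distr_distr) (auto simp: comp_def)
  also have "\<dots> = distr \<pi> \<pi> (\<lambda>p. p)"
    using graph sets by (intro distr_cong_AE) (auto simp: prod_eq_iff)
  finally show ?thesis by (simp add: distr_id)
qed

section \<open>The twist condition forces a graph\<close>

text \<open>This is the local form of being carried by a graph: up to null sets, mass that leaves
  the vicinity of \<open>x\<close> for that of \<open>y\<close> starts outside \<open>D\<close>, and
  mass leaving for that of \<open>z\<close> starts inside \<open>D\<close>. The zero set of the
  density towards \<open>y\<close> serves as \<open>D\<close> once \<open>E\<close>, where both
  densities are positive, is known to be \<open>m\<close>-null.\<close>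

lemma LMTC_separates_fibres:
  fixes m :: "'a::polish_space measure" and c :: "'a \<times> 'a \<Rightarrow> ennreal"
  assumes proper: "proper_space TYPE('a)" and lf: "locally_finite_borel m" and dbl: "doubling m"
    and twist: "LMTC m c" and "prob_space \<pi>" and sets_\<pi>: "sets \<pi> = sets borel"
    and ac: "absolutely_continuous m (distr \<pi> borel fst)"
    and mono: "AE p in \<pi>. AE q in \<pi>. c p + c q \<le> c (fst p, snd q) + c (fst q, snd p)"
    and "y \<noteq> z"
  shows "\<exists>r1>0. \<exists>r2>0. \<exists>D\<in>sets borel. D \<times> ball y r2 \<in> null_sets \<pi>
    \<and> (ball x r1 - D) \<times> ball z r2 \<in> null_sets \<pi>"
proof -
  interpret prob_space \<pi> by fact
  have sets: "sets m = sets borel" using lf by (simp add: locally_finite_borel_def)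
  have fin: "\<And>x r. emeasure m (ball x r) < \<infinity>" using proper lf by (rule proper_emeasure_ball_finite)
  have sf: "sigma_finite_measure m" using sets fin by (rule sigma_finite_measure_if_balls_finite)
  obtain r1 r2 where r: "r1 > 0" "r2 > 0" and lim: "\<And>xb. xb \<in> ball x r1 \<Longrightarrow> Liminf (at_right 0)
      (\<lambda>s. outer_measure_of m (Fset c s r2 xb y z) / emeasure m (ball xb s)) > 0"
    using twist[unfolded LMTC_def, THEN spec, THEN spec, THEN spec, THEN mp, OF \<open>y \<noteq> z\<close>, of x] by blast
  \<comment> \<open>Closed balls of half the radius are compact because the space is proper, as
    \<open>null_set_tube\<close> requires, and they lie in the open balls where the twist inequality
    is available.\<close>
  define K1 where "K1 = cball y (r2 / 2)"
  define K2 where "K2 = cball z (r2 / 2)"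
  have K: "compact K1" "compact K2" using proper by (auto simp: proper_space_def K1_def K2_def)
  have K_ball: "K1 \<subseteq> ball y r2" "K2 \<subseteq> ball z r2" using r by (auto simp: K1_def K2_def)
  obtain g1 :: "'a \<Rightarrow> ennreal" where g1: "g1 \<in> borel_measurable borel"
    "\<And>W. W \<in> sets borel \<Longrightarrow> emeasure \<pi> (W \<times> K1) = (\<integral>\<^sup>+a. g1 a * indicator W a \<partial>m)"
    using plan_slice_density[OF sf sets sets_\<pi> ac borel_compact[OF K(1)]] by blast
  obtain g2 :: "'a \<Rightarrow> ennreal" where g2: "g2 \<in> borel_measurable borel"
    "\<And>W. W \<in> sets borel \<Longrightarrow> emeasure \<pi> (W \<times> K2) = (\<integral>\<^sup>+a. g2 a * indicator W a \<partial>m)"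
    using plan_slice_density[OF sf sets sets_\<pi> ac borel_compact[OF K(2)]] by blast
  note [measurable] = g1(1) g2(1) and [measurable_cong] = sets
  define V where "V = ball x r1"
  define D where "D = {a. g1 a = 0}"
  define E where "E = {a \<in> V. g1 a \<noteq> 0 \<and> g2 a \<noteq> 0}"
  have [measurable]: "V \<in> sets borel" "D \<in> sets borel" "E \<in> sets borel"
    unfolding V_def D_def E_def by measurable
  have null_slice1: "AE a in m. a \<notin> W"
    if "W \<in> sets borel" "W \<subseteq> E" "emeasure \<pi> (W \<times> K1) = 0" for W
  proof -
    note [measurable] = that(1)
    have "AE a in m. g1 a * indicator W a = 0" using that g1(2) by (simp add: nn_integral_0_iff_AE)
    then show ?thesis
      by eventually_elim (use that(2) in \<open>auto simp: E_def indicator_def split: if_splits\<close>)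
  qed
  have null_slice2: "AE a in m. a \<notin> W"
    if "W \<in> sets borel" "W \<subseteq> E" "emeasure \<pi> (W \<times> K2) = 0" for W
  proof -
    note [measurable] = that(1)
    have "AE a in m. g2 a * indicator W a = 0" using that g2(2) by (simp add: nn_integral_0_iff_AE)
    then show ?thesis
      by eventually_elim (use that(2) in \<open>auto simp: E_def indicator_def split: if_splits\<close>)
  qed
  have E_null: "AE a in m. a \<notin> E"
  proof -
    obtain Q where Q: "Q \<in> null_sets m" "\<And>a. a \<in> E - Q \<Longrightarrow>
        \<not> 0 < Liminf (at_right 0) (\<lambda>s. emeasure m (ball a s - E) / emeasure m (ball a s))"
    proof -
      have "E \<subseteq> V" "open V" "emeasure m V < \<infinity>" using fin by (auto simp: V_def E_def)
      from doubling_density[OF sets dbl \<open>E \<in> sets borel\<close> this] show thesis using that by blast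
    qed
    have [measurable]: "Q \<in> sets borel" using Q(1) sets by auto
    obtain N0 where N0: "{p \<in> space \<pi>. \<not> (AE q in \<pi>. c p + c q \<le> c (fst p, snd q) + c (fst q, snd p))} \<subseteq> N0"
      "N0 \<in> sets \<pi>" "emeasure \<pi> N0 = 0"
      using mono by (elim AE_E) auto
    \<comment> \<open>It is enough that every such \<open>p\<close> violates monotonicity against a
      non-null set of \<open>q\<close>: then \<open>(E - Q) \<times> K1\<close> is null for \<pi>,
      and positivity of \<open>g1\<close> on \<open>E\<close> makes \<open>E - Q\<close> null for
      \<open>m\<close>.\<close>
    have "(E - Q) \<times> K1 \<subseteq> N0"
    proof
      fix p assume p: "p \<in> (E - Q) \<times> K1"
      define a where "a = fst p"
      have a: "a \<in> E" "a \<notin> Q" "snd p \<in> ball y r2" using p K_ball by (auto simp: a_def)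
      show "p \<in> N0"
      proof (rule ccontr)
        assume "p \<notin> N0"
        then have AE_q: "AE q in \<pi>. c p + c q \<le> c (fst p, snd q) + c (fst q, snd p)"
          using N0(1) sets_eq_imp_space_eq[OF sets_\<pi>] by auto
        obtain N where N: "{q \<in> space \<pi>. \<not> c p + c q \<le> c (fst p, snd q) + c (fst q, snd p)} \<subseteq> N"
          "N \<in> sets \<pi>" "emeasure \<pi> N = 0"
          using AE_q by (elim AE_E) auto
        define S where "S = {b \<in> E. \<forall>y'\<in>ball y r2. \<forall>z'\<in>ball z r2.
            c (b, y') + c (a, z') < c (a, y') + c (b, z')}"
        \<comment> \<open>With \<open>y' = snd p\<close> and \<open>z' = snd q\<close> the twist
          inequality says that exchanging the targets of \<open>p\<close> and \<open>q\<close>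
          lowers the cost, which \<open>AE_q\<close> permits only inside the null set
          \<open>N\<close>.\<close>
        have SN: "S \<times> K2 \<subseteq> N"
        proof
          fix q assume q: "q \<in> S \<times> K2"
          then have "fst q \<in> S" "snd q \<in> K2" by auto
          then have "c (fst q, snd p) + c (a, snd q) < c (a, snd p) + c (fst q, snd q)"
            using a(3) K_ball(2) unfolding S_def by blast
          then have "\<not> c p + c q \<le> c (fst p, snd q) + c (fst q, snd p)"
            by (simp add: a_def add.commute not_le)
          then show "q \<in> N" using N(1) sets_eq_imp_space_eq[OF sets_\<pi>] by auto
        qed
        obtain Z where Z: "Z \<in> sets borel" "S \<subseteq> Z" "emeasure \<pi> (Z \<times> K2) = 0"
          using null_set_tube[OF sets_\<pi> finite_measure_axioms null_setsI[OF N(3,2)] K(2) SN] .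
        note [measurable] = Z(1)
        have "Z \<times> K2 \<in> sets \<pi>" unfolding sets_\<pi> by (intro borel_Times Z(1) borel_compact K(2))
        then have "emeasure \<pi> ((Z \<inter> E) \<times> K2) \<le> emeasure \<pi> (Z \<times> K2)" by (intro emeasure_mono) auto
        then have "AE b in m. b \<notin> Z \<inter> E" using Z by (intro null_slice2) simp_all
        then have ZE: "emeasure m (Z \<inter> E) = 0"
          by (subst (asm) AE_iff_null_sets[symmetric]) auto
        \<comment> \<open>Points of the twist set inside \<open>E\<close> belong to \<open>S\<close>
          and thus to the \<open>m\<close>-null set \<open>Z \<inter> E\<close>; all others lie in
          the ball outside \<open>E\<close>. Hence the twist lower bound passes to the quotient that
          the choice of \<open>Q\<close> controls.\<close>
        have F_le: "outer_measure_of m (Fset c s r2 a y z) \<le> emeasure m (ball a s - E)" for s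
        proof -
          have "Fset c s r2 a y z \<inter> E \<subseteq> S" by (auto simp: Fset_def S_def)
          moreover have "Fset c s r2 a y z \<subseteq> ball a s" by (auto simp: Fset_def)
          ultimately have "Fset c s r2 a y z \<subseteq> (Z \<inter> E) \<union> (ball a s - E)" using Z(2) by blast
          then have "outer_measure_of m (Fset c s r2 a y z) \<le> outer_measure_of m ((Z \<inter> E) \<union> (ball a s - E))"
            by (rule outer_measure_of_mono)
          also have "\<dots> = emeasure m ((Z \<inter> E) \<union> (ball a s - E))" by (rule outer_measure_of_eq) measurable
          also have "\<dots> \<le> emeasure m (Z \<inter> E) + emeasure m (ball a s - E)"
            by (rule emeasure_subadditive) measurable
          finally show ?thesis using ZE by simp
        qed
        have "0 < Liminf (at_right 0) (\<lambda>s. outer_measure_of m (Fset c s r2 a y z) / emeasure m (ball a s))"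
          using a(1) by (intro lim) (simp add: E_def V_def)
        also have "\<dots> \<le> Liminf (at_right 0) (\<lambda>s. emeasure m (ball a s - E) / emeasure m (ball a s))"
          by (intro Liminf_mono always_eventually allI divide_right_mono_ennreal F_le)
        finally show False using Q(2)[of a] a by simp
      qed
    qed
    then have "emeasure \<pi> ((E - Q) \<times> K1) = 0"
      using emeasure_mono[of "(E - Q) \<times> K1" N0 \<pi>] N0(2,3) by simp
    then have "AE a in m. a \<notin> E - Q" by (intro null_slice1) auto
    with AE_not_in[OF Q(1)] show ?thesis by eventually_elim auto
  qed
  have Times_null: "W \<times> ball w (r2 / 2) \<in> null_sets \<pi>"
    if "W \<in> sets borel" "emeasure \<pi> (W \<times> cball w (r2 / 2)) = 0" for W w
  proof -
    have "W \<times> cball w (r2 / 2) \<in> null_sets \<pi>"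
      using that(2) by (rule null_setsI) (unfold sets_\<pi>, intro borel_Times that(1) borel_closed closed_cball)
    moreover have "W \<times> ball w (r2 / 2) \<in> sets \<pi>"
      unfolding sets_\<pi> by (intro borel_Times that(1) borel_open open_ball)
    ultimately show ?thesis by (rule null_sets_subset) auto
  qed
  have "emeasure \<pi> (D \<times> K1) = 0"
    unfolding g1(2)[OF \<open>D \<in> sets borel\<close>] by (subst nn_integral_0_iff_AE) (auto simp: D_def indicator_def)
  \<comment> \<open>On \<open>V - D\<close> the density \<open>g1\<close> is nonzero, so
    \<open>g2\<close> vanishes there except on the null set \<open>E\<close>.\<close>
  moreover have "emeasure \<pi> ((V - D) \<times> K2) = 0"
  proof -
    have "AE a in m. g2 a * indicator (V - D) a = 0"
      using E_null by eventually_elim (auto simp: E_def D_def indicator_def)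
    then show ?thesis by (subst g2(2)) (auto simp: nn_integral_0_iff_AE)
  qed
  ultimately have "D \<times> ball y (r2 / 2) \<in> null_sets \<pi>" "(V - D) \<times> ball z (r2 / 2) \<in> null_sets \<pi>"
    unfolding K1_def K2_def by (auto intro!: Times_null)
  then show ?thesis using r \<open>D \<in> sets borel\<close> unfolding V_def
    by (intro exI[of _ r1] exI[of _ "r2 / 2"] conjI bexI[of _ D]) auto
qed

text \<open>Each triple \<open>t\<close> in \<open>J\<close> has an open neighbourhood
  \<open>O' t\<close> such that every \<open>(x, y, z)\<close> in it has \<open>(x, y)\<close> or
  \<open>(x, z)\<close> in the null set \<open>B t\<close>, according to whether \<open>x\<close>
  belongs to \<open>D t\<close>. By the Lindelof property countably many neighbourhoods cover
  \<open>J\<close>, and discarding the corresponding \<open>B t\<close> leaves single-valued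
  fibres.\<close>

lemma separated_fibres_imp_functional:
  fixes \<pi> :: "('a::polish_space \<times> 'a) measure"
  assumes sets: "sets \<pi> = sets borel"
    and sep: "\<And>x y z. y \<noteq> z \<Longrightarrow> \<exists>r1>0. \<exists>r2>0. \<exists>D\<in>sets borel. D \<times> ball y r2 \<in> null_sets \<pi>
      \<and> (ball x r1 - D) \<times> ball z r2 \<in> null_sets \<pi>"
  obtains \<Gamma> where "\<Gamma> \<in> sets borel" "AE p in \<pi>. p \<in> \<Gamma>"
    "\<And>x y z. (x, y) \<in> \<Gamma> \<Longrightarrow> (x, z) \<in> \<Gamma> \<Longrightarrow> y = z"
proof -
  define J where "J = {(x :: 'a, y :: 'a, z :: 'a). y \<noteq> z}"
  define R where "R t r1 r2 D \<longleftrightarrow> (case t of (x :: 'a, y, z) \<Rightarrow> r1 > (0::real) \<and> r2 > 0 \<and> D \<in> sets borel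
      \<and> D \<times> ball y r2 \<in> null_sets \<pi> \<and> (ball x r1 - D) \<times> ball z r2 \<in> null_sets \<pi>)" for t r1 r2 D
  have "\<exists>r1 r2 D. R t r1 r2 D" if tJ: "t \<in> J" for t
  proof -
    obtain x y z where t: "t = (x, y, z)" "y \<noteq> z" using tJ by (cases t) (auto simp: J_def)
    show ?thesis using sep[OF t(2), of x] unfolding t R_def prod.case by blast
  qed
  then obtain r1 r2 D where R: "\<And>t. t \<in> J \<Longrightarrow> R t (r1 t) (r2 t) (D t)"
    by metis
  note * = R[unfolded R_def]
  define O' where "O' = (\<lambda>t. case t of (x, y, z) \<Rightarrow> ball x (r1 t) \<times> ball y (r2 t) \<times> ball z (r2 t))"
  define B where "B = (\<lambda>t. case t of (x, y, z) \<Rightarrow> D t \<times> ball y (r2 t) \<union> (ball x (r1 t) - D t) \<times> ball z (r2 t))"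
  have O'_open: "open (O' t)" for t unfolding O'_def by (cases t) (auto intro!: open_Times)
  have "\<And>S. S \<in> O' ` J \<Longrightarrow> open S" using O'_open by auto
  then obtain \<F> where \<F>: "\<F> \<subseteq> O' ` J" "countable \<F>" "\<Union>\<F> = \<Union>(O' ` J)"
    using Lindelof[of "O' ` J"] by metis
  then obtain I where I: "I \<subseteq> J" "countable I" "\<F> = O' ` I"
    using countable_subset_image[of \<F> O' J] by auto
  have B_null: "B t \<in> null_sets \<pi>" if "t \<in> J" for t
    using *[OF that] by (auto simp: B_def split: prod.splits)
  have bad: "(\<Union>t\<in>I. B t) \<in> null_sets \<pi>" using I B_null by (intro null_sets_UN') auto
  show thesis
  proof
    show "- (\<Union>t\<in>I. B t) \<in> sets borel" using null_setsD2[OF bad] unfolding sets by (rule borel_comp)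
    show "AE p in \<pi>. p \<in> - (\<Union>t\<in>I. B t)" using AE_not_in[OF bad] by simp
    fix x y z assume xyz: "(x, y) \<in> - (\<Union>t\<in>I. B t)" "(x, z) \<in> - (\<Union>t\<in>I. B t)"
    show "y = z"
    proof (rule ccontr)
      assume "y \<noteq> z"
      then have "(x, y, z) \<in> J" by (auto simp: J_def)
      moreover from *[OF this] have "(x, y, z) \<in> O' (x, y, z)" by (auto simp: O'_def)
      ultimately have "(x, y, z) \<in> \<Union>\<F>" unfolding \<F>(3) by blast
      then obtain t where "t \<in> I" "(x, y, z) \<in> O' t" using I by blast
      then have "(x, y) \<in> B t \<or> (x, z) \<in> B t" by (cases t) (auto simp: O'_def B_def)
      with xyz \<open>t \<in> I\<close> show False by blast
    qed
  qed
qed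

lemma optimal_plan_concentrated_on_graph:
  fixes m :: "'a::polish_space measure" and c :: "'a \<times> 'a \<Rightarrow> ennreal"
  assumes "proper_space TYPE('a)" "locally_finite_borel m" "doubling m"
    and c: "c \<in> borel_measurable borel" and "LMTC m c"
    and ac: "absolutely_continuous m \<mu>" and opt: "\<pi> \<in> OptPlans c \<mu> \<nu>"
  obtains T where "T \<in> borel_measurable borel" "AE p in \<pi>. snd p = T (fst p)"
proof -
  have \<pi>: "prob_space \<pi>" "sets \<pi> = sets borel" "distr \<pi> borel fst = \<mu>"
    using opt by (auto simp: OptPlans_def Adm_def)
  have "\<exists>r1>0. \<exists>r2>0. \<exists>D\<in>sets borel. D \<times> ball y r2 \<in> null_sets \<pi>
      \<and> (ball x r1 - D) \<times> ball z r2 \<in> null_sets \<pi>" if "y \<noteq> z" for x y z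
    using assms(1-3,5) \<pi>(1,2) ac[folded \<pi>(3)] optimal_plan_swap_AE[OF c opt] that
    by (rule LMTC_separates_fibres)
  then obtain \<Gamma> where \<Gamma>: "\<Gamma> \<in> sets borel" "AE p in \<pi>. p \<in> \<Gamma>"
    "\<And>x y z. (x, y) \<in> \<Gamma> \<Longrightarrow> (x, z) \<in> \<Gamma> \<Longrightarrow> y = z"
    using separated_fibres_imp_functional[OF \<pi>(2)] by metis
  show thesis
    by (rule functional_borel_set_map[OF prob_space.finite_measure[OF \<pi>(1)] \<pi>(2) \<Gamma>(1,2)])
      (use \<Gamma>(3) that in blast)+
qed

section \<open>Uniqueness by averaging\<close>

text \<open>Cost and marginals are affine in the plan, so the mean of two optimal plans is optimal.
  Both plans are absolutely continuous with respect to it, so whatever holds almost everywhere for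
  the mean holds for each of them.\<close>

lemma optimal_plans_average:
  fixes c :: "'a::polish_space \<times> 'a \<Rightarrow> ennreal"
  assumes c: "c \<in> borel_measurable borel" and 1: "\<pi>1 \<in> OptPlans c \<mu> \<nu>" and 2: "\<pi>2 \<in> OptPlans c \<mu> \<nu>"
  obtains \<pi> where "\<pi> \<in> OptPlans c \<mu> \<nu>" "null_sets \<pi> \<subseteq> null_sets \<pi>1" "null_sets \<pi> \<subseteq> null_sets \<pi>2"
proof -
  define \<kappa> where "\<kappa> b = (if b then \<pi>1 else \<pi>2)" for b
  \<comment> \<open>The mean is encoded as a fair coin toss followed by sampling from the chosen
    plan, so the rules for \<open>bind\<close> yield its measure and its integrals.\<close>
  define \<pi> where "\<pi> = measure_pmf (bernoulli_pmf (1/2)) \<bind> \<kappa>"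
  have P: "prob_space \<pi>1" "prob_space \<pi>2" "sets \<pi>1 = sets borel" "sets \<pi>2 = sets borel"
    "distr \<pi>1 borel fst = \<mu>" "distr \<pi>1 borel snd = \<nu>" "distr \<pi>2 borel fst = \<mu>" "distr \<pi>2 borel snd = \<nu>"
    using 1 2 by (auto simp: OptPlans_def Adm_def)
  have \<kappa>: "\<kappa> \<in> measure_pmf (bernoulli_pmf (1/2)) \<rightarrow>\<^sub>M subprob_algebra borel"
    using P by (auto simp: \<kappa>_def space_subprob_algebra prob_space_imp_subprob_space)
  have "ennreal (1/2) + ennreal (1/2) = 1" by (subst ennreal_plus[symmetric]) auto
  then have half: "t * ennreal (1/2) + t * ennreal (1/2) = t" for t
    by (metis distrib_left mult.right_neutral)
  have sets: "sets \<pi> = sets borel" unfolding \<pi>_def using \<kappa> by (subst sets_bind[where N=borel]) (auto simp: \<kappa>_def P)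
  have em: "emeasure \<pi> X = emeasure \<pi>1 X * ennreal (1/2) + emeasure \<pi>2 X * ennreal (1/2)"
    if "X \<in> sets borel" for X
    unfolding \<pi>_def using that by (subst emeasure_bind[OF _ \<kappa>]) (auto simp: \<kappa>_def)
  have int: "(\<integral>\<^sup>+p. c p \<partial>\<pi>) = (\<integral>\<^sup>+p. c p \<partial>\<pi>1) * ennreal (1/2) + (\<integral>\<^sup>+p. c p \<partial>\<pi>2) * ennreal (1/2)"
    unfolding \<pi>_def by (subst nn_integral_bind[OF c \<kappa>]) (auto simp: \<kappa>_def)
  have marg: "distr \<pi> borel f = \<rho>"
    if f: "f \<in> borel_measurable borel" and f12: "distr \<pi>1 borel f = \<rho>" "distr \<pi>2 borel f = \<rho>"
    for f :: "'a \<times> 'a \<Rightarrow> 'a" and \<rho>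
  proof (rule measure_eqI)
    show "sets (distr \<pi> borel f) = sets \<rho>" using f12(1) by auto
    fix W assume "W \<in> sets (distr \<pi> borel f)"
    then have W: "W \<in> sets borel" by simp
    have em_f: "emeasure (distr M borel f) W = emeasure M (f -` W)" if "sets M = sets borel" for M
      using f W that sets_eq_imp_space_eq[OF that] by (subst emeasure_distr) (auto simp: measurable_cong_sets[OF that refl])
    have "f -` W \<in> sets borel" using measurable_sets[OF f W] by simp
    then have "emeasure (distr \<pi> borel f) W =
        emeasure (distr \<pi>1 borel f) W * ennreal (1/2) + emeasure (distr \<pi>2 borel f) W * ennreal (1/2)"
      using em_f sets P em by simp
    then show "emeasure (distr \<pi> borel f) W = emeasure \<rho> W" using f12 half by simp
  qed
  have "prob_space \<pi>"
  proof
    have "space \<pi> = UNIV" "space \<pi>1 = UNIV" "space \<pi>2 = UNIV"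
      using sets_eq_imp_space_eq[OF sets] sets_eq_imp_space_eq[OF P(3)] sets_eq_imp_space_eq[OF P(4)] by auto
    then show "emeasure \<pi> (space \<pi>) = 1"
      using em[of UNIV] half[of 1] prob_space.emeasure_space_1[OF P(1)] prob_space.emeasure_space_1[OF P(2)] by simp
  qed
  moreover have "distr \<pi> borel fst = \<mu>" "distr \<pi> borel snd = \<nu>"
    using P by (auto intro!: marg borel_measurable_continuous_onI continuous_on_fst continuous_on_snd continuous_on_id)
  ultimately have "\<pi> \<in> Adm \<mu> \<nu>" using sets by (simp add: Adm_def)
  moreover have "(\<integral>\<^sup>+p. c p \<partial>\<pi>1) = (\<integral>\<^sup>+p. c p \<partial>\<pi>2)"
    using 1 2 by (intro antisym) (auto simp: OptPlans_def)
  then have "(\<integral>\<^sup>+p. c p \<partial>\<pi>) = (\<integral>\<^sup>+p. c p \<partial>\<pi>1)" using int half by simp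
  ultimately have "\<pi> \<in> OptPlans c \<mu> \<nu>" using 1 by (simp add: OptPlans_def)
  moreover have "null_sets \<pi> \<subseteq> null_sets \<pi>1" "null_sets \<pi> \<subseteq> null_sets \<pi>2"
    using em sets P by (auto simp: null_sets_def)
  ultimately show thesis by (rule that)
qed

theorem theorem1p1:
  fixes m :: "'a::polish_space measure" and c :: "'a \<times> 'a \<Rightarrow> ennreal"
  assumes "proper_space TYPE('a)"
    and "locally_finite_borel m"
    and "doubling m"
    and "lsc c"
    and "LMTC m c"
  shows "\<forall>\<mu> \<in> prob_measures. \<forall>\<nu> \<in> prob_measures.
           absolutely_continuous m \<mu> \<and> OptPlans c \<mu> \<nu> \<noteq> {} \<longrightarrow>
           (\<exists>!\<pi>. \<pi> \<in> OptPlans c \<mu> \<nu>) \<and>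
           (\<forall>\<pi> \<in> OptPlans c \<mu> \<nu>. induced_by_map \<pi> \<mu>)"
proof (intro ballI impI)
  fix \<mu> \<nu> :: "'a measure"
  assume "\<mu> \<in> prob_measures" and H: "absolutely_continuous m \<mu> \<and> OptPlans c \<mu> \<nu> \<noteq> {}"
  then have sets_\<mu>: "sets \<mu> = sets borel" by (simp add: prob_measures_def)
  have c: "c \<in> borel_measurable borel" using \<open>lsc c\<close> by (rule lsc_borel_measurable)
  note graph = optimal_plan_concentrated_on_graph[OF assms(1-3) c assms(5), of \<mu> _ \<nu>]
  have adm: "\<pi> \<in> Adm \<mu> \<nu>" if "\<pi> \<in> OptPlans c \<mu> \<nu>" for \<pi> using that by (simp add: OptPlans_def)
  have unique: "\<pi>1 = \<pi>2" if opt: "\<pi>1 \<in> OptPlans c \<mu> \<nu>" "\<pi>2 \<in> OptPlans c \<mu> \<nu>" for \<pi>1 \<pi>2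
  proof -
    \<comment> \<open>The graph carrying the mean also carries both plans; with the common first
      marginal \<mu> each of them is the image of \<mu> under the same map.\<close>
    obtain \<pi> where \<pi>: "\<pi> \<in> OptPlans c \<mu> \<nu>" "null_sets \<pi> \<subseteq> null_sets \<pi>1" "null_sets \<pi> \<subseteq> null_sets \<pi>2"
      using optimal_plans_average[OF c opt] .
    obtain T where T: "T \<in> borel_measurable borel" "AE p in \<pi>. snd p = T (fst p)"
      using graph[of \<pi>] H \<pi>(1) by blast
    have "AE p in \<rho>. snd p = T (fst p)" if "null_sets \<pi> \<subseteq> null_sets \<rho>" "\<rho> \<in> Adm \<mu> \<nu>" for \<rho>
    proof -
      have "space \<rho> = space \<pi>"
        using that(2) adm[OF \<pi>(1)] by (intro sets_eq_imp_space_eq) (simp add: Adm_def)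
      then show ?thesis using T(2) that(1) unfolding eventually_ae_filter by auto
    qed
    then have "\<rho> = distr \<mu> borel (\<lambda>x. (x, T x))"
      if "null_sets \<pi> \<subseteq> null_sets \<rho>" "\<rho> \<in> Adm \<mu> \<nu>" for \<rho>
      using that plan_eq_distr_graph T(1) by blast
    from this[OF \<pi>(2) adm[OF opt(1)]] this[OF \<pi>(3) adm[OF opt(2)]] show ?thesis by simp
  qed
  have "induced_by_map \<pi> \<mu>" if opt: "\<pi> \<in> OptPlans c \<mu> \<nu>" for \<pi>
  proof -
    obtain T where T: "T \<in> borel_measurable borel" "AE p in \<pi>. snd p = T (fst p)"
      using graph[of \<pi>] H opt by blast
    moreover have "T \<in> borel_measurable \<mu>" using T(1) measurable_cong_sets[OF sets_\<mu> refl] by auto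
    ultimately show ?thesis
      unfolding induced_by_map_def using plan_eq_distr_graph[OF adm[OF opt]] by blast
  qed
  then show "(\<exists>!\<pi>. \<pi> \<in> OptPlans c \<mu> \<nu>) \<and> (\<forall>\<pi> \<in> OptPlans c \<mu> \<nu>. induced_by_map \<pi> \<mu>)"
    using H unique by blast
qed

end
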